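(* Let $n\ge 2$. For every order-$n$ Latin square $L$, $$n-1\le\Sigma(L)\le (n-1)^2.$$ Consequently $T_n(m)=0$ whenever $m<n-1$ or $m>(n-1)^2$; and both bounds are attained, i.e. there exist order-$n$ Latin squares $L,L'$ with $\Sigma(L)=n-1$ and $\Sigma(L')=(n-1)^2$.
   Context: $[n]=\{1,\dots,n\}$. An order-$n$ Latin square is an $n\times n$ matrix $L=(L(i,j))_{1\le i,j\le n}$ with entries in $[n]$ such that every row and every column is a permutation of $[n]$. For $1\le j\le n$, $k_j(L)$ is the number of ascents of the $j$-th column, i.e. the number of indices $i\in\{1,\dots,n-1\}$ with $L(i,j)<L(i+1,j)$. The total ascent statistic is $\Sigma(L)=\sum_{j=1}^n k_j(L)$, and $T_n(m)$ is the number of order-$n$ Latin squares $L$ with $\Sigma(L)=m$. *)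

theory Defs
  imports "HOL-Library.FuncSet"
begin

text \<open>
  Matrices are represented as curried functions \<open>L i j\<close> with row index \<open>i\<close> and column index \<open>j\<close>
  in \<open>{1..n}\<close>. They are extensional (undefined outside the index range), so that distinct functions
  are distinct matrices and counting them with \<^const>\<open>card\<close> is meaningful.
\<close>

definition latin_squares :: "nat \<Rightarrow> (nat \<Rightarrow> nat \<Rightarrow> nat) set" where
  "latin_squares n =
    {L \<in> {1..n} \<rightarrow>\<^sub>E ({1..n} \<rightarrow>\<^sub>E {1..n}).
       (\<forall>i\<in>{1..n}. bij_betw (\<lambda>j. L i j) {1..n} {1..n}) \<and>
       (\<forall>j\<in>{1..n}. bij_betw (\<lambda>i. L i j) {1..n} {1..n})}"

definition column_ascents :: "nat \<Rightarrow> (nat \<Rightarrow> nat \<Rightarrow> nat) \<Rightarrow> nat \<Rightarrow> nat" where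
  "column_ascents n L j = card {i \<in> {1..n - 1}. L i j < L (i + 1) j}"

definition total_ascents :: "nat \<Rightarrow> (nat \<Rightarrow> nat \<Rightarrow> nat) \<Rightarrow> nat" where
  "total_ascents n L = (\<Sum>j = 1..n. column_ascents n L j)"

definition num_latin_squares :: "nat \<Rightarrow> nat \<Rightarrow> nat" where
  "num_latin_squares n m = card {L \<in> latin_squares n. total_ascents n L = m}"

text \<open>Since these sets are finite, a count of \<open>0\<close> really means that no such square exists.\<close>

lemma finite_latin_squares: "finite (latin_squares n)"
  unfolding latin_squares_def
  by (rule finite_subset[of _ "{1..n} \<rightarrow>\<^sub>E ({1..n} \<rightarrow>\<^sub>E {1..n})"]) (auto intro!: finite_PiE)

end

theory Submission
  imports Defs
begin

text \<open>
  Count the ascents between two consecutive rows instead of along a column. Each row is a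
  permutation of \<open>{1..n}\<close>, so exactly one of its entries is \<open>n\<close>, and below that entry there can
  be no ascent. Hence each of the \<open>n - 1\<close> pairs of consecutive rows contributes at most \<open>n - 1\<close>
  ascents, which is the upper bound. Equality means that the entry below every \<open>v < n\<close> is larger
  than \<open>v\<close>; in the cyclic square the entry below \<open>v\<close> is \<open>v + 1\<close>, and \<open>1\<close> follows \<open>n\<close>, so it
  attains the bound.

  The lower bound follows by symmetry. Replacing every entry \<open>v\<close> by \<open>n + 1 - v\<close> is an
  involution on Latin squares that exchanges ascents and descents, and since adjacent entries of a
  column differ, the totals of a square and of its complement add up to \<open>n (n - 1)\<close>. As
  \<open>n (n - 1) - (n - 1)\<^sup>2 = n - 1\<close>, the complement carries the upper bound and the extremal cyclic
  square to the lower bound and a square attaining it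
  (\<open>total_ascents_le\<close>, \<open>total_ascents_cyclic_square\<close>, \<open>total_ascents_complement\<close>).
\<close>

lemma latin_square_row:
  "L \<in> latin_squares n \<Longrightarrow> i \<in> {1..n} \<Longrightarrow> bij_betw (L i) {1..n} {1..n}"
  by (simp add: latin_squares_def)

lemma latin_square_column:
  "L \<in> latin_squares n \<Longrightarrow> j \<in> {1..n} \<Longrightarrow> bij_betw (\<lambda>i. L i j) {1..n} {1..n}"
  by (simp add: latin_squares_def)

lemma latin_square_entry:
  "L \<in> latin_squares n \<Longrightarrow> i \<in> {1..n} \<Longrightarrow> j \<in> {1..n} \<Longrightarrow> L i j \<in> {1..n}"
  by (blast dest: latin_square_row bij_betwE)

lemma restrict_latin_square:
  assumes "\<And>i. i \<in> {1..n} \<Longrightarrow> bij_betw (f i) {1..n} {1..n}"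
    and "\<And>j. j \<in> {1..n} \<Longrightarrow> bij_betw (\<lambda>i. f i j) {1..n} {1..n}"
  shows "(\<lambda>i\<in>{1..n}. \<lambda>j\<in>{1..n}. f i j) \<in> latin_squares n"
proof -
  have "bij_betw (\<lambda>j. (\<lambda>i\<in>{1..n}. \<lambda>j\<in>{1..n}. f i j) i j) {1..n} {1..n}" if "i \<in> {1..n}" for i
    using assms(1)[OF that] that by (subst bij_betw_cong[where g = "f i"]) auto
  moreover have "bij_betw (\<lambda>i. (\<lambda>i\<in>{1..n}. \<lambda>j\<in>{1..n}. f i j) i j) {1..n} {1..n}" if "j \<in> {1..n}" for j
    using assms(2)[OF that] that by (subst bij_betw_cong[where g = "\<lambda>i. f i j"]) auto
  moreover have "(\<lambda>i\<in>{1..n}. \<lambda>j\<in>{1..n}. f i j) \<in> {1..n} \<rightarrow>\<^sub>E ({1..n} \<rightarrow>\<^sub>E {1..n})"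
    using assms(1)[THEN bij_betw_apply] by (intro restrict_PiE_iff[THEN iffD2] ballI)
  ultimately show ?thesis
    unfolding latin_squares_def by blast
qed

lemma total_ascents_by_rows:
  "total_ascents n L = (\<Sum>i = 1..n - 1. card {j \<in> {1..n}. L i j < L (i + 1) j})"
proof -
  have "total_ascents n L = (\<Sum>j = 1..n. \<Sum>i = 1..n - 1. if L i j < L (i + 1) j then 1 else 0)"
    by (simp add: total_ascents_def column_ascents_def sum.If_cases Int_def)
  also have "\<dots> = (\<Sum>i = 1..n - 1. \<Sum>j = 1..n. if L i j < L (i + 1) j then 1 else 0)"
    by (rule sum.swap)
  also have "\<dots> = (\<Sum>i = 1..n - 1. card {j \<in> {1..n}. L i j < L (i + 1) j})"
    by (simp add: sum.If_cases Int_def)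
  finally show ?thesis .
qed

lemma card_row_not_maximal:
  assumes "L \<in> latin_squares n" "i \<in> {1..n}"
  shows "card {j \<in> {1..n}. L i j \<noteq> n} = n - 1"
proof -
  have row: "bij_betw (L i) {1..n} {1..n}"
    using assms by (rule latin_square_row)
  have "bij_betw (L i) {j \<in> {1..n}. L i j \<noteq> n} ({1..n} - {n})"
    using row by (rule bij_betw_subset) (use bij_betw_imp_surj_on[OF row] in blast)+
  then have "card {j \<in> {1..n}. L i j \<noteq> n} = card ({1..n} - {n})"
    by (rule bij_betw_same_card)
  also have "\<dots> = n - 1"
    using assms by simp
  finally show ?thesis .
qed

lemma total_ascents_le:
  assumes L: "L \<in> latin_squares n"
  shows "total_ascents n L \<le> (n - 1)^2"
proof -
  have "card {j \<in> {1..n}. L i j < L (i + 1) j} \<le> n - 1" if i: "i \<in> {1..n - 1}" for i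
  proof -
    have rows: "i \<in> {1..n}" "i + 1 \<in> {1..n}"
      using i by auto
    have "{j \<in> {1..n}. L i j < L (i + 1) j} \<subseteq> {j \<in> {1..n}. L i j \<noteq> n}"
      using latin_square_entry[OF L rows(2)] by fastforce
    then have "card {j \<in> {1..n}. L i j < L (i + 1) j} \<le> card {j \<in> {1..n}. L i j \<noteq> n}"
      by (intro card_mono) auto
    then show ?thesis
      using card_row_not_maximal[OF L rows(1)] by simp
  qed
  then have "total_ascents n L \<le> (\<Sum>i = 1..n - 1. n - 1)"
    unfolding total_ascents_by_rows by (rule sum_mono)
  then show ?thesis
    by (simp add: power2_eq_square)
qed

definition complement :: "nat \<Rightarrow> (nat \<Rightarrow> nat \<Rightarrow> nat) \<Rightarrow> nat \<Rightarrow> nat \<Rightarrow> nat" where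
  "complement n L = (\<lambda>i\<in>{1..n}. \<lambda>j\<in>{1..n}. n + 1 - L i j)"

lemma complement_latin_square:
  assumes "L \<in> latin_squares n"
  shows "complement n L \<in> latin_squares n"
proof -
  have reflect: "bij_betw (\<lambda>v. n + 1 - v) {1..n} {1..n}"
    by (rule bij_betw_byWitness[where f' = "\<lambda>v. n + 1 - v"]) auto
  show ?thesis
    unfolding complement_def
    using bij_betw_trans[OF latin_square_row[OF assms] reflect]
      bij_betw_trans[OF latin_square_column[OF assms] reflect]
    by (intro restrict_latin_square) (simp_all add: comp_def)
qed

text \<open>
  Two adjacent entries of a column are distinct, so each of the \<open>n (n - 1)\<close> vertical adjacencies is
  an ascent either of the square or of its complement, never of both.
\<close>

lemma total_ascents_complement:
  assumes L: "L \<in> latin_squares n"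
  shows "total_ascents n L + total_ascents n (complement n L) = n * (n - 1)"
proof -
  have "column_ascents n L j + column_ascents n (complement n L) j = n - 1"
    if j: "j \<in> {1..n}" for j
  proof -
    let ?A = "{i \<in> {1..n - 1}. L i j < L (i + 1) j}"
    have ascent_iff: "complement n L i j < complement n L (i + 1) j \<longleftrightarrow> \<not> L i j < L (i + 1) j"
      if i: "i \<in> {1..n - 1}" for i
    proof -
      have rows: "i \<in> {1..n}" "i + 1 \<in> {1..n}"
        using i by auto
      have "L i j \<noteq> L (i + 1) j"
        using inj_onD[OF bij_betw_imp_inj_on[OF latin_square_column[OF L j]] _ rows] by auto
      moreover have "L i j \<in> {1..n}" "L (i + 1) j \<in> {1..n}"
        using latin_square_entry[OF L _ j] rows by blast+
      ultimately show ?thesis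
        using rows j by (simp add: complement_def) linarith
    qed
    have "{i \<in> {1..n - 1}. complement n L i j < complement n L (i + 1) j} = {1..n - 1} - ?A"
      using ascent_iff by blast
    moreover have "{1..n - 1} \<inter> ?A = ?A"
      by blast
    then have "card ?A + card ({1..n - 1} - ?A) = n - 1"
      using card_Int_Diff[OF finite_atLeastAtMost, of 1 "n - 1" ?A]
      by (simp only: card_atLeastAtMost diff_Suc_1)
    ultimately show ?thesis
      by (simp only: column_ascents_def)
  qed
  then show ?thesis
    by (simp add: total_ascents_def flip: sum.distrib)
qed

lemma total_ascents_complement_maximal:
  assumes "n \<ge> 1" "L \<in> latin_squares n" "total_ascents n L = (n - 1)^2"
  shows "total_ascents n (complement n L) = n - 1"
proof -
  have "n * (n - 1) = (n - 1)^2 + (n - 1)"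
    using assms(1) by (cases n) (auto simp: power2_eq_square)
  then show ?thesis
    using total_ascents_complement[OF assms(2)] assms(3) by simp
qed

lemma total_ascents_ge:
  assumes "n \<ge> 1" "L \<in> latin_squares n"
  shows "n - 1 \<le> total_ascents n L"
proof -
  have "n * (n - 1) = (n - 1)^2 + (n - 1)"
    using assms(1) by (cases n) (auto simp: power2_eq_square)
  then show ?thesis
    using total_ascents_complement[OF assms(2)]
      total_ascents_le[OF complement_latin_square[OF assms(2)]] by simp
qed

text \<open>The addition table of the integers modulo \<open>n\<close>, with each residue \<open>r < n\<close> written as \<open>r + 1\<close>.\<close>

definition cyclic_square :: "nat \<Rightarrow> nat \<Rightarrow> nat \<Rightarrow> nat" where
  "cyclic_square n = (\<lambda>i\<in>{1..n}. \<lambda>j\<in>{1..n}. 1 + (i + j) mod n)"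

lemma cyclic_shift_bij: "bij_betw (\<lambda>j. 1 + (c + j) mod n) {1..n} {1..n}" for c n :: nat
proof -
  have "inj_on (\<lambda>j. 1 + (c + j) mod n) {1..n}"
  proof (rule linorder_inj_onI)
    fix j k assume jk: "j < k" "j \<in> {1..n}" "k \<in> {1..n}"
    show "1 + (c + j) mod n \<noteq> 1 + (c + k) mod n"
    proof
      assume "1 + (c + j) mod n = 1 + (c + k) mod n"
      then have "n dvd (c + k) - (c + j)"
        using jk by (metis add_left_cancel mod_eq_dvd_iff_nat add_le_cancel_left less_imp_le)
      then show False
        using jk by (auto dest: dvd_imp_le)
    qed
  qed auto
  moreover have "(\<lambda>j. 1 + (c + j) mod n) ` {1..n} \<subseteq> {1..n}"
    by (auto simp: Suc_le_eq)
  ultimately show ?thesis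
    by (simp add: bij_betw_def endo_inj_surj)
qed

lemma cyclic_square_latin_square: "cyclic_square n \<in> latin_squares n"
  unfolding cyclic_square_def
  using cyclic_shift_bij by (intro restrict_latin_square) (simp_all add: add.commute)

lemma total_ascents_cyclic_square: "total_ascents n (cyclic_square n) = (n - 1)^2"
proof -
  let ?L = "cyclic_square n"
  have "card {j \<in> {1..n}. ?L i j < ?L (i + 1) j} = n - 1" if i: "i \<in> {1..n - 1}" for i
  proof -
    have rows: "i \<in> {1..n}" "i + 1 \<in> {1..n}"
      using i by auto
    have "?L i j < ?L (i + 1) j \<longleftrightarrow> ?L i j \<noteq> n" if "j \<in> {1..n}" for j
      using rows that by (auto simp: cyclic_square_def mod_Suc)
    then have "{j \<in> {1..n}. ?L i j < ?L (i + 1) j} = {j \<in> {1..n}. ?L i j \<noteq> n}"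
      by blast
    then show ?thesis
      using card_row_not_maximal[OF cyclic_square_latin_square rows(1)] by simp
  qed
  then show ?thesis
    by (simp add: total_ascents_by_rows power2_eq_square)
qed

theorem theorem4p2:
  fixes n :: nat
  assumes "n \<ge> 2"
  shows "(\<forall>L \<in> latin_squares n. n - 1 \<le> total_ascents n L \<and> total_ascents n L \<le> (n - 1)^2) \<and>
         (\<forall>m::nat. m < n - 1 \<or> m > (n - 1)^2 \<longrightarrow> num_latin_squares n m = 0) \<and>
         (\<exists>L \<in> latin_squares n. total_ascents n L = n - 1) \<and>
         (\<exists>L' \<in> latin_squares n. total_ascents n L' = (n - 1)^2)"
proof -
  have n: "n \<ge> 1"
    using assms by simp
  have bounds: "\<forall>L \<in> latin_squares n. n - 1 \<le> total_ascents n L \<and> total_ascents n L \<le> (n - 1)^2"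
    using total_ascents_ge[OF n] total_ascents_le by blast
  have "num_latin_squares n m = 0" if m: "m < n - 1 \<or> m > (n - 1)^2" for m
  proof -
    have "{L \<in> latin_squares n. total_ascents n L = m} = {}"
      using bounds m by (auto simp: not_less[symmetric])
    then show ?thesis
      by (simp only: num_latin_squares_def card.empty)
  qed
  moreover have "\<exists>L \<in> latin_squares n. total_ascents n L = n - 1"
    using total_ascents_complement_maximal[OF n cyclic_square_latin_square total_ascents_cyclic_square]
      complement_latin_square[OF cyclic_square_latin_square] by blast
  moreover have "\<exists>L' \<in> latin_squares n. total_ascents n L' = (n - 1)^2"
    using cyclic_square_latin_square total_ascents_cyclic_square by blast
  ultimately show ?thesis
    using bounds by blast
qed

end
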